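(* Let $d\ge1$ be an integer, $\kappa\in(0,1)$, and let $p,s,\beta$ be real numbers with $0<p<\infty$ and $d+sp\ge0$. Suppose $D\ne\emptyset$ is a proper $\kappa$-plump open set in $\mathbb{R}^d$ such that at least one of the following conditions holds: (T) $\overline{\mathrm{dim}}_A(\partial D)<d-sp+\beta$ and $D$ is unbounded; (F) $\underline{\mathrm{dim}}_A(\partial D)>d-sp+\beta$, and $D$ is bounded or $\partial D$ is unbounded. Then $D$ admits an $(s,p,\beta)$-Hardy inequality, i.e. there is a constant $c>0$ such that for all $u\in C_0^\infty(D)$ $$\int_D\frac{|u(x)|^p}{\delta_x^{sp}}\,\delta_x^\beta\,dx\le c\int_D\int_D\frac{|u(x)-u(y)|^p}{|x-y|^{d+sp}}\,\delta_x^\beta\,dy\,dx .$$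
   Context: $\delta_x=\mathrm{dist}(x,\mathbb{R}^d\setminus D)$; $C_0^\infty(D)$ is the space of smooth functions with compact support in $D$; $B(x,r)$ is the open and $\bar B(x,r)$ the closed Euclidean ball; diameters may be $+\infty$. Plumpness: a set $A\subset\mathbb{R}^d$ is $\kappa$-plump with $\kappa\in(0,1)$ if for each $0<r<\mathrm{diam}(A)$ and each $x\in\overline{A}$ there is $z\in\bar B(x,r)$ with $B(z,\kappa r)\subset A$. Assouad dimensions of $\emptyset\ne E\subset\mathbb{R}^d$: the lower Assouad dimension $\underline{\mathrm{dim}}_A(E)$ is the supremum of all $\lambda\ge0$ for which there is $C>0$ such that, whenever $0<r<R<2\,\mathrm{diam}(E)$ and $x\in E$, at least $C(R/r)^\lambda$ balls centred in $E$ and of radius $r$ are needed to cover $B(x,R)\cap E$. The upper Assouad dimension $\overline{\mathrm{dim}}_A(E)$ is the infimum of all $\lambda\ge0$ for which there is $C>0$ such that, whenever $0<r<R<2\,\mathrm{diam}(E)$ and $x\in E$, the set $E\cap B(x,R)$ can be covered by at most $C(R/r)^\lambda$ balls centred in $E$ and of radius $r$. *)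

theory Defs
  imports "HOL-Analysis.Analysis"
begin

text \<open>The library \<open>diameter\<close> is a real number and is meaningful for bounded sets only.\<close>

definition ediam :: "'a::metric_space set \<Rightarrow> ereal" where
  "ediam A = (if bounded A then ereal (diameter A) else \<infinity>)"

definition plump :: "real \<Rightarrow> 'a::euclidean_space set \<Rightarrow> bool" where
  "plump \<kappa> A \<longleftrightarrow>
     (\<forall>r. 0 < r \<and> ereal r < ediam A \<longrightarrow>
        (\<forall>x\<in>closure A. \<exists>z\<in>cball x r. ball z (\<kappa> * r) \<subseteq> A))"

text \<open>In the two dimensions below, a finite set \<open>F\<close> of centres stands for the family of the
  balls \<open>ball y r\<close> with \<open>y \<in> F\<close>. A cover by infinitely many balls trivially has at
  least \<open>C * (R / r) powr a\<close> members, so finite families suffice in both cases.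
  The dimensions are extended reals because a one-point set has lower
  dimension \<open>\<infinity>\<close> under this definition (no \<open>R\<close> is admissible).\<close>

definition lower_assouad_dim :: "'a::euclidean_space set \<Rightarrow> ereal" where
  "lower_assouad_dim E = Sup {ereal a | a. 0 \<le> a \<and>
     (\<exists>C>0. \<forall>r R x. 0 < r \<and> r < R \<and> ereal R < 2 * ediam E \<and> x \<in> E \<longrightarrow>
        (\<forall>F. finite F \<and> F \<subseteq> E \<and> ball x R \<inter> E \<subseteq> (\<Union>y\<in>F. ball y r) \<longrightarrow>
           C * (R / r) powr a \<le> real (card F)))}"

definition upper_assouad_dim :: "'a::euclidean_space set \<Rightarrow> ereal" where
  "upper_assouad_dim E = Inf {ereal a | a. 0 \<le> a \<and>
     (\<exists>C>0. \<forall>r R x. 0 < r \<and> r < R \<and> ereal R < 2 * ediam E \<and> x \<in> E \<longrightarrow>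
        (\<exists>F. finite F \<and> F \<subseteq> E \<and> ball x R \<inter> E \<subseteq> (\<Union>y\<in>F. ball y r) \<and>
           real (card F) \<le> C * (R / r) powr a))}"

primrec Ck :: "nat \<Rightarrow> ('a::euclidean_space \<Rightarrow> real) \<Rightarrow> bool" where
  "Ck 0 f \<longleftrightarrow> continuous_on UNIV f"
| "Ck (Suc k) f \<longleftrightarrow> (\<forall>x. f differentiable (at x)) \<and>
     (\<forall>b\<in>Basis. Ck k (\<lambda>x. frechet_derivative f (at x) b))"

definition smooth :: "('a::euclidean_space \<Rightarrow> real) \<Rightarrow> bool" where
  "smooth f \<longleftrightarrow> (\<forall>k. Ck k f)"

text \<open>Elements of \<open>C\<^sub>0\<^sup>\<infinity>(D)\<close> are represented by their extension by zero to the whole space.\<close>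

definition test_functions :: "'a::euclidean_space set \<Rightarrow> ('a \<Rightarrow> real) set" where
  "test_functions D =
     {u. smooth u \<and> compact (closure {x. u x \<noteq> 0}) \<and> closure {x. u x \<noteq> 0} \<subseteq> D}"

definition bdist :: "'a::euclidean_space set \<Rightarrow> 'a \<Rightarrow> real" where
  "bdist D x = infdist x (- D)"

text \<open>Both integrals are taken in \<open>[0, \<infinity>]\<close>; the right-hand side may be infinite. On the
  diagonal \<open>x = y\<close> the integrand evaluates to \<open>0\<close>.\<close>

definition admits_Hardy :: "real \<Rightarrow> real \<Rightarrow> real \<Rightarrow> 'a::euclidean_space set \<Rightarrow> bool" where
  "admits_Hardy s p \<beta> D \<longleftrightarrow>
     (\<exists>c::real. 0 < c \<and> (\<forall>u\<in>test_functions D.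
        (\<integral>\<^sup>+x\<in>D. ennreal (\<bar>u x\<bar> powr p / bdist D x powr (s * p) * bdist D x powr \<beta>) \<partial>lborel)
        \<le> ennreal c *
          (\<integral>\<^sup>+x\<in>D. (\<integral>\<^sup>+y\<in>D.
             ennreal (\<bar>u x - u y\<bar> powr p / norm (x - y) powr (real DIM('a) + s * p)
                      * bdist D x powr \<beta>) \<partial>lborel) \<partial>lborel)))"

end

theory Submission
  imports Defs
begin

text \<open>Write \<open>d\<close> for the dimension, \<open>\<delta>\<close> for the distance to the complement of \<open>D\<close>,
  \<open>\<gamma> = \<beta> - s * p\<close>, and \<open>I\<close> for the left-hand side, the integral of \<open>\<bar>u\<bar>\<^sup>p \<delta>\<^sup>\<gamma>\<close> over \<open>D\<close>.
  The proof compares \<open>u x\<close> with the values of \<open>u\<close> on a large set \<open>\<Gamma> x\<close> of points \<open>y\<close> at a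
  distance of order \<open>\<delta> x\<close> from \<open>x\<close>, but lying in a different layer around the boundary.
  Averaging \<open>\<bar>u x\<bar>\<^sup>p \<le> 2\<^sup>p (\<bar>u x - u y\<bar>\<^sup>p + \<bar>u y\<bar>\<^sup>p)\<close> over \<open>y \<in> \<Gamma> x\<close> and integrating
  against \<open>\<delta>\<^sup>\<gamma>\<close> gives two terms. As \<open>d + s * p \<ge> 0\<close>, the kernel is bounded below at
  distance \<open>\<lesssim> \<delta> x\<close>, and the first term is at most a multiple of the right-hand side. After an
  exchange of integrals, the second is again an integral of \<open>\<bar>u\<bar>\<^sup>p\<close> against some weight. If that
  weight is at most half of \<open>\<delta>\<^sup>\<gamma>\<close>, it can be absorbed, since \<open>I\<close> is finite for a test
  function. This is \<open>Hardy_of_averaging\<close>; it works for all \<open>p > 0\<close>.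

  It remains to choose \<open>\<Gamma>\<close>, depending on a parameter \<open>M\<close>, such that the weight carries a negative
  power of \<open>M\<close>; then \<open>M\<close> is taken large.

  If the boundary is thin, one moves away from it: \<open>\<Gamma> x\<close> consists of points with
  \<open>\<delta> y \<approx> M * \<delta> x\<close>, and contains a ball of radius \<open>\<approx> M * \<delta> x\<close> because \<open>D\<close> is plump and
  unbounded. A point \<open>y\<close> is then used by the \<open>x\<close> in a boundary layer of width \<open>\<delta> y / M\<close> and
  diameter \<open>\<approx> \<delta> y\<close>. Covering the boundary by \<open>\<lesssim> M\<^sup>a\<close> balls, where the exponent \<open>a\<close> is an
  admissible one for the upper Assouad dimension, bounds the volume of the layer by a multiple of
  \<open>M\<^sup>a\<^sup>-\<^sup>d (\<delta> y)\<^sup>d\<close>. The weight is then at most a multiple of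
  \<open>M\<^sup>a\<^sup>-\<^sup>d\<^sup>-\<^sup>\<gamma> (\<delta> y)\<^sup>\<gamma>\<close>, and \<open>a < d + \<gamma>\<close>.

  If the boundary is fat, one moves towards it: \<open>\<Gamma> x\<close> consists of points with
  \<open>\<delta> y \<approx> \<delta> x / M\<close>. The lower Assouad dimension gives \<open>\<gtrsim> M\<^sup>a\<close> boundary points near \<open>x\<close>,
  separated by \<open>\<delta> x / M\<close>; plumpness puts a ball of comparable radius in \<open>D\<close> next to each
  of them, and these balls are disjoint, so that \<open>\<Gamma> x\<close> has volume
  \<open>\<gtrsim> M\<^sup>a\<^sup>-\<^sup>d (\<delta> x)\<^sup>d\<close>. All \<open>x\<close> that use \<open>y\<close> lie in one ball of radius
  \<open>\<approx> M * \<delta> y\<close>, and the weight is at most a multiple of \<open>M\<^sup>d\<^sup>+\<^sup>\<gamma>\<^sup>-\<^sup>a (\<delta> y)\<^sup>\<gamma>\<close>, where now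
  \<open>a > d + \<gamma>\<close>.\<close>

section \<open>The distance to the boundary\<close>

lemma continuous_on_bdist: "continuous_on S (bdist D)"
  unfolding bdist_def by (intro continuous_intros)

lemma bdist_measurable [measurable]: "bdist D \<in> borel_measurable borel"
  by (intro borel_measurable_continuous_onI continuous_on_bdist)

lemma bdist_pos_iff:
  assumes "open D" "D \<noteq> UNIV"
  shows "0 < bdist D x \<longleftrightarrow> x \<in> D"
proof -
  have "closed (- D)" "- D \<noteq> {}" using assms by auto
  then have "x \<in> - D \<longleftrightarrow> infdist x (- D) = 0" by (intro in_closed_iff_infdist_zero)
  then show ?thesis unfolding bdist_def using infdist_nonneg[of x "- D"] by auto
qed

lemma bdist_le_dist: "w \<notin> D \<Longrightarrow> bdist D x \<le> dist x w"
  unfolding bdist_def by (intro infdist_le) auto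

lemma bdist_le_add_dist: "bdist D x \<le> bdist D y + dist x y"
  unfolding bdist_def by (rule infdist_triangle)

lemma ball_bdist_subset: "ball x (bdist D x) \<subseteq> D"
  using bdist_le_dist[of _ D x] by (force simp: not_less[symmetric])

lemma bdist_ge_of_ball_subset:
  assumes "ball z r \<subseteq> D" "D \<noteq> UNIV"
  shows "r - dist y z \<le> bdist D y"
proof -
  have "r \<le> dist z w" if "w \<notin> D" for w
    using assms that by (meson in_mono mem_ball not_le)
  then have "r - dist y z \<le> dist y w" if "w \<notin> D" for w
    using that dist_triangle[of z w y] by (fastforce simp: dist_commute)
  then show ?thesis unfolding bdist_def infdist_def using assms
    by (auto intro!: cINF_greatest)
qed

lemma nearest_frontier_point:
  fixes D :: "'a::euclidean_space set"
  assumes "open D" "D \<noteq> UNIV" "x \<in> D"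
  obtains w where "w \<in> frontier D" "dist x w = bdist D x"
proof -
  have "closed (- D)" "- D \<noteq> {}" using assms by auto
  then obtain w where w: "w \<in> - D" "infdist x (- D) = dist x w"
    by (rule infdist_attains_inf)
  have "w \<in> closure (ball x (dist x w))"
  proof -
    have "x \<noteq> w" using w assms by auto
    then show ?thesis by simp
  qed
  then have "w \<in> closure D"
    using ball_bdist_subset[of x D] w closure_mono unfolding bdist_def by (metis subsetD)
  then have "w \<in> frontier D" using w assms by (simp add: frontier_def interior_open)
  with w that show ?thesis unfolding bdist_def by auto
qed

text \<open>A line through \<open>x\<close> leaves a bounded set on both sides of \<open>x\<close>, each time after a length of
  at least \<open>bdist D x\<close>. Hence, for bounded \<open>D\<close>, the scales \<open>\<delta> x\<close> are admissible
  in the lower Assouad dimension of the boundary.\<close>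

lemma bdist_le_diameter_frontier:
  fixes D :: "'a::euclidean_space set"
  assumes "open D" "bounded D" "x \<in> D"
  shows "2 * bdist D x \<le> diameter (frontier D)"
proof -
  obtain b :: 'a where b: "b \<in> Basis" using nonempty_Basis by blast
  then have "b \<noteq> 0" "- b \<noteq> 0" "norm b = 1" by auto
  have "x \<in> interior D" using assms by (simp add: interior_open)
  obtain d1 where d1: "0 < d1" "x + d1 *\<^sub>R b \<in> frontier D"
    using ray_to_frontier[OF \<open>bounded D\<close> \<open>x \<in> interior D\<close> \<open>b \<noteq> 0\<close>] by metis
  obtain d2 where d2: "0 < d2" "x + d2 *\<^sub>R (- b) \<in> frontier D"
    using ray_to_frontier[OF \<open>bounded D\<close> \<open>x \<in> interior D\<close> \<open>- b \<noteq> 0\<close>] by metis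
  have out: "w \<notin> D" if "w \<in> frontier D" for w
    using that assms by (simp add: frontier_def interior_open)
  have "bdist D x \<le> d1" "bdist D x \<le> d2"
    using bdist_le_dist[OF out[OF d1(2)], of x] bdist_le_dist[OF out[OF d2(2)], of x]
      d1 d2 \<open>norm b = 1\<close> by (auto simp: dist_norm)
  moreover have "dist (x + d1 *\<^sub>R b) (x + d2 *\<^sub>R (- b)) = d1 + d2"
  proof -
    have "x + d1 *\<^sub>R b - (x + d2 *\<^sub>R (- b)) = (d1 + d2) *\<^sub>R b" by (simp add: algebra_simps)
    then show ?thesis using d1 d2 \<open>norm b = 1\<close> by (simp add: dist_norm)
  qed
  moreover have "dist (x + d1 *\<^sub>R b) (x + d2 *\<^sub>R (- b)) \<le> diameter (frontier D)"
    using d1 d2 assms by (intro diameter_bounded_bound) (auto simp: frontier_def intro: bounded_subset[OF bounded_closure])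
  ultimately show ?thesis by linarith
qed

lemma bdist_le_diameter:
  fixes D :: "'a::euclidean_space set"
  assumes "open D" "bounded D" "x \<in> D"
  shows "bdist D x \<le> diameter D"
proof -
  obtain b :: 'a where b: "b \<in> Basis" using nonempty_Basis by blast
  have "diameter (frontier D) \<le> diameter (closure D)"
    using assms by (intro diameter_subset) (auto simp: frontier_def)
  then show ?thesis using bdist_le_diameter_frontier[OF assms] assms
    by (simp add: diameter_closure) (smt (verit) bdist_def infdist_nonneg)
qed

section \<open>Absorption\<close>

lemma powr_triangle:
  fixes a b p :: real
  assumes "0 < p"
  shows "\<bar>a\<bar> powr p \<le> 2 powr p * (\<bar>a - b\<bar> powr p + \<bar>b\<bar> powr p)"
proof -
  let ?m = "max \<bar>a - b\<bar> \<bar>b\<bar>"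
  have "\<bar>a\<bar> \<le> 2 * ?m" by (auto simp: max_def abs_if)
  then have "\<bar>a\<bar> powr p \<le> (2 * ?m) powr p" using assms by (intro powr_mono2) auto
  also have "\<dots> = 2 powr p * ?m powr p" by (simp add: powr_mult)
  also have "?m powr p \<le> \<bar>a - b\<bar> powr p + \<bar>b\<bar> powr p" by (cases "\<bar>a - b\<bar> \<le> \<bar>b\<bar>") auto
  finally show ?thesis by simp
qed

lemma le_of_le_half_add:
  fixes a b :: ennreal
  assumes "a \<le> b + ennreal (1/2) * a" "a < \<infinity>"
  shows "a \<le> 2 * b"
proof (cases "b = \<infinity>")
  case False
  then obtain B where B: "b = ennreal B" "0 \<le> B" by (cases b) auto
  obtain A where A: "a = ennreal A" "0 \<le> A" using assms by (cases a) auto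
  have "ennreal A \<le> ennreal (B + 1/2 * A)"
    using assms(1) A B by (metis ennreal_mult' ennreal_plus half_gt_zero_iff less_imp_le mult_nonneg_nonneg zero_less_one)
  then have "A \<le> B + 1/2 * A" using A B by (simp add: ennreal_le_iff del: ennreal_plus)
  then have "ennreal A \<le> ennreal (2 * B)" by (intro ennreal_leI) simp
  then show ?thesis using A B by (simp add: ennreal_mult)
qed (simp add: ennreal_mult_top)

text \<open>On the compact support the distance is bounded away from zero, so the weight is bounded there
  for every exponent, negative ones included. This finiteness is what allows absorption.\<close>

lemma weighted_norm_finite:
  fixes D :: "'a::euclidean_space set"
  assumes "open D" "D \<noteq> UNIV" "0 < p" "u \<in> test_functions D"
  shows "(\<integral>\<^sup>+x\<in>D. ennreal (\<bar>u x\<bar> powr p * bdist D x powr e) \<partial>lborel) < \<infinity>"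
proof -
  define K where "K = closure {x. u x \<noteq> 0}"
  have "Ck 0 u" and K: "compact K" "K \<subseteq> D"
    using assms unfolding test_functions_def smooth_def K_def by blast+
  from this(1) have u: "continuous_on UNIV u" by simp
  let ?f = "\<lambda>x. \<bar>u x\<bar> powr p * bdist D x powr e"
  have "bdist D x \<noteq> 0" if "x \<in> K" for x
    using that K bdist_pos_iff[OF assms(1,2), of x] by auto
  then have "continuous_on K ?f"
    using continuous_on_subset[OF u] assms(3)
    by (intro continuous_intros continuous_on_bdist continuous_on_powr') auto
  then have "bounded (?f ` K)" by (intro compact_imp_bounded compact_continuous_image K(1))
  then obtain B where bound: "\<forall>v\<in>?f ` K. norm v \<le> B"
    unfolding bounded_iff by (elim exE)
  have B: "?f x \<le> B" if "x \<in> K" for x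
  proof -
    have "norm (?f x) \<le> B" by (rule bspec[OF bound imageI[OF that]])
    then show ?thesis by (simp only: real_norm_def abs_le_iff)
  qed
  have "(\<integral>\<^sup>+x\<in>D. ennreal (?f x) \<partial>lborel) \<le> (\<integral>\<^sup>+x. ennreal B * indicator K x \<partial>lborel)"
  proof (intro nn_integral_mono)
    fix x
    have "u x = 0" if "x \<notin> K" using that closure_subset[of "{x. u x \<noteq> 0}"] unfolding K_def by auto
    moreover have "ennreal (?f x) \<le> ennreal B" "x \<in> D" if "x \<in> K"
      using B[OF that] that K by (auto intro: ennreal_leI)
    ultimately show "ennreal (?f x) * indicator D x \<le> ennreal B * indicator K x"
      by (cases "x \<in> K") simp_all
  qed
  also have "\<dots> = ennreal B * emeasure lborel K"
    using K by (intro nn_integral_cmult_indicator) (auto intro: borel_compact)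
  also have "\<dots> < \<infinity>"
    using emeasure_bounded_finite[OF compact_imp_bounded[OF K(1)]]
    by (simp add: ennreal_mult_less_top)
  finally show ?thesis .
qed

text \<open>The relation \<open>\<Gamma>\<close> says which \<open>y\<close> serve as comparison points for \<open>x\<close>. Its sections
  over \<open>x\<close> are averaged over; \<open>fat\<close> says that they are large at scale \<open>\<delta> x\<close>, and \<open>near\<close> that the kernel
  is bounded below on them. In \<open>thin\<close>, the integral over the section under \<open>y\<close> is, up to the
  normalisation \<open>m\<close>, the weight that \<open>\<bar>u y\<bar>\<^sup>p\<close> receives after the integrals are exchanged. The
  factor \<open>2\<^sup>-\<^sup>p / 2\<close> there cancels the \<open>2\<^sup>p\<close> of the triangle inequality and leaves a half of the
  original integral.\<close>

theorem Hardy_of_averaging: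
  fixes D :: "'a::euclidean_space set" and \<Gamma> :: "('a \<times> 'a) set" and s p \<beta> m K :: real
  assumes "open D" "D \<noteq> UNIV" "0 < p" "0 \<le> real DIM('a) + s * p" "0 < m" "0 < K"
    and meas: "\<Gamma> \<in> sets borel" and sub: "\<Gamma> \<subseteq> D \<times> D"
    and near: "\<And>x y. (x, y) \<in> \<Gamma> \<Longrightarrow> dist x y \<le> K * bdist D x"
    and fat: "\<And>x. x \<in> D \<Longrightarrow>
      ennreal (m * bdist D x ^ DIM('a)) \<le> emeasure lborel {y. (x, y) \<in> \<Gamma>}"
    and thin: "\<And>y. y \<in> D \<Longrightarrow>
      (\<integral>\<^sup>+x\<in>{x. (x, y) \<in> \<Gamma>}. ennreal (bdist D x powr (\<beta> - s * p - real DIM('a))) \<partial>lborel)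
        \<le> ennreal (m * (2 powr - p / 2) * bdist D y powr (\<beta> - s * p))"
  shows "admits_Hardy s p \<beta> D"
proof -
  define n where "n = DIM('a)"
  define \<gamma> where "\<gamma> = \<beta> - s * p"
  define \<delta> where "\<delta> = bdist D"
  define c0 where "c0 = 2 powr p / m"
  define c where "c = 2 * (c0 * K powr (real n + s * p))"
  have [measurable]: "\<Gamma> \<in> sets (borel \<Otimes>\<^sub>M borel)"
    using meas by (subst borel_prod)
  have [measurable]: "D \<in> sets borel" "\<delta> \<in> borel_measurable borel"
    using \<open>open D\<close> by (auto simp: \<delta>_def bdist_measurable)
  have c0: "0 < c0" using assms by (simp add: c0_def)
  have "0 < c" using assms c0 by (simp add: c_def)
  moreover have
    "(\<integral>\<^sup>+x\<in>D. ennreal (\<bar>u x\<bar> powr p / \<delta> x powr (s * p) * \<delta> x powr \<beta>) \<partial>lborel)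
        \<le> ennreal c * (\<integral>\<^sup>+x\<in>D. (\<integral>\<^sup>+y\<in>D. ennreal (\<bar>u x - u y\<bar> powr p /
             norm (x - y) powr (real n + s * p) * \<delta> x powr \<beta>) \<partial>lborel) \<partial>lborel)"
    if u: "u \<in> test_functions D" for u
  proof -
    have "Ck 0 u" using u unfolding test_functions_def smooth_def by blast
    then have [measurable]: "u \<in> borel_measurable borel"
      by (auto intro: borel_measurable_continuous_onI)
    define k where "k x y = \<bar>u x - u y\<bar> powr p / norm (x - y) powr (real n + s * p) * \<delta> x powr \<beta>"
      for x y
    have [measurable]: "(\<lambda>(x, y). k x y) \<in> borel_measurable (borel \<Otimes>\<^sub>M borel)"
      unfolding k_def by measurable
    have [measurable]: "k x \<in> borel_measurable borel" for x
      unfolding k_def by measurable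
    define w where "w x = \<delta> x powr (\<gamma> - real n)" for x
    have [measurable]: "w \<in> borel_measurable borel" unfolding w_def by measurable
    define f where "f x = \<bar>u x\<bar> powr p" for x
    have [measurable]: "f \<in> borel_measurable borel" unfolding f_def by measurable
    have nn: "0 \<le> k x y" "0 \<le> w x" "0 \<le> f x" for x y
      by (auto simp: k_def w_def f_def)
    have pos: "0 < \<delta> x" if "x \<in> D" for x
      using that bdist_pos_iff[OF assms(1,2)] by (simp add: \<delta>_def)
    define I where "I = (\<integral>\<^sup>+x\<in>D. ennreal (f x * \<delta> x powr \<gamma>) \<partial>lborel)"
    define J where "J = (\<integral>\<^sup>+x\<in>D. (\<integral>\<^sup>+y\<in>D. ennreal (k x y) \<partial>lborel) \<partial>lborel)"
    define ind where "ind x y = (indicator \<Gamma> (x, y) :: ennreal)" for x y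
    have [measurable]: "(\<lambda>(x, y). ind x y) \<in> borel_measurable (borel \<Otimes>\<^sub>M borel)"
      unfolding ind_def by measurable
    have [measurable]: "ind x \<in> borel_measurable borel" for x
      unfolding ind_def by measurable

    \<comment> \<open>The exponent of \<open>norm (x - y)\<close> is nonnegative, so the bound \<open>norm (x - y) \<le> K * \<delta> x\<close>
      may be raised to it. The case \<open>x = y\<close> is separate because the kernel is \<open>0\<close> there.\<close>
    have kernel: "w x * \<bar>u x - u y\<bar> powr p \<le> K powr (real n + s * p) * k x y" if "(x, y) \<in> \<Gamma>" for x y
    proof (cases "x = y")
      case True then show ?thesis by (simp add: k_def)
    next
      case False
      have x: "0 < \<delta> x" using that sub pos by blast
      have "norm (x - y) powr (real n + s * p) \<le> (K * \<delta> x) powr (real n + s * p)"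
        using near[OF that] assms(4) by (intro powr_mono2) (auto simp: dist_norm \<delta>_def n_def)
      also have "\<dots> = K powr (real n + s * p) * \<delta> x powr (real n + s * p)" by (simp add: powr_mult)
      finally have le: "norm (x - y) powr (real n + s * p)
          \<le> K powr (real n + s * p) * \<delta> x powr (real n + s * p)" .
      have "w x = \<delta> x powr \<beta> / \<delta> x powr (real n + s * p)"
        unfolding w_def \<gamma>_def by (simp add: powr_diff[symmetric] algebra_simps)
      also have "\<dots> = K powr (real n + s * p) * \<delta> x powr \<beta> /
          (K powr (real n + s * p) * \<delta> x powr (real n + s * p))" using \<open>0 < K\<close> by simp
      also have "\<dots> \<le> K powr (real n + s * p) * \<delta> x powr \<beta> / norm (x - y) powr (real n + s * p)"
        using le False by (intro divide_left_mono) (auto intro!: mult_pos_pos simp: x \<open>0 < K\<close>[THEN less_imp_neq, symmetric] x[THEN less_imp_neq, symmetric])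
      finally have "w x * \<bar>u x - u y\<bar> powr p \<le> K powr (real n + s * p) * \<delta> x powr \<beta> /
          norm (x - y) powr (real n + s * p) * \<bar>u x - u y\<bar> powr p"
        by (rule mult_right_mono) simp
      then show ?thesis by (simp add: k_def field_simps)
    qed
    have point: "ennreal (f x * \<delta> x powr \<gamma>) * indicator D x
        \<le> (\<integral>\<^sup>+y. ennreal (c0 * K powr (real n + s * p)) * (ennreal (k x y) * indicator D y * indicator D x) \<partial>lborel)
          + (\<integral>\<^sup>+y. ennreal c0 * (ennreal (f y) * (ennreal (w x) * ind x y)) \<partial>lborel)" for x
    proof (cases "x \<in> D")
      case True
      have "f x * \<delta> x powr \<gamma> = 1 / m * (f x * w x) * (m * \<delta> x ^ n)"
        using pos[OF True] \<open>0 < m\<close> by (simp add: w_def powr_diff powr_realpow)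
      then have "ennreal (f x * \<delta> x powr \<gamma>)
          = ennreal (1 / m * (f x * w x)) * ennreal (m * \<delta> x ^ n)"
        using \<open>0 < m\<close> pos[OF True] nn by (simp add: ennreal_mult[symmetric])
      also have "\<dots> \<le> ennreal (1 / m * (f x * w x)) * emeasure lborel {y. (x, y) \<in> \<Gamma>}"
        using fat[OF True] by (intro mult_left_mono) (auto simp: \<delta>_def n_def)
      also have "\<dots> = (\<integral>\<^sup>+y. ennreal (1 / m * (f x * w x)) * indicator {y. (x, y) \<in> \<Gamma>} y \<partial>lborel)"
        by (intro nn_integral_cmult_indicator[symmetric]) measurable
      also have "\<dots> \<le> (\<integral>\<^sup>+y. ennreal (c0 * K powr (real n + s * p)) * (ennreal (k x y) * indicator D y * indicator D x)
          + ennreal c0 * (ennreal (f y) * (ennreal (w x) * ind x y)) \<partial>lborel)"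
      proof (intro nn_integral_mono)
        fix y
        show "ennreal (1 / m * (f x * w x)) * indicator {y. (x, y) \<in> \<Gamma>} y
          \<le> ennreal (c0 * K powr (real n + s * p)) * (ennreal (k x y) * indicator D y * indicator D x)
          + ennreal c0 * (ennreal (f y) * (ennreal (w x) * ind x y))"
        proof (cases "(x, y) \<in> \<Gamma>")
          case G: True
          then have "y \<in> D" using sub by auto
          have "f x * w x \<le> (2 powr p * (\<bar>u x - u y\<bar> powr p + f y)) * w x"
            using powr_triangle[OF \<open>0 < p\<close>, of "u x" "u y"] nn
            by (intro mult_right_mono) (auto simp: f_def)
          also have "\<dots> = 2 powr p * (w x * \<bar>u x - u y\<bar> powr p + f y * w x)"
            by (simp add: algebra_simps)
          also have "\<dots> \<le> 2 powr p * (K powr (real n + s * p) * k x y + f y * w x)"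
            using kernel[OF G] by (intro mult_left_mono add_right_mono) auto
          finally have "1 / m * (f x * w x) \<le> 1 / m * (2 powr p * (K powr (real n + s * p) * k x y + f y * w x))"
            using \<open>0 < m\<close> by (intro mult_left_mono) auto
          also have "\<dots> = c0 * K powr (real n + s * p) * k x y + c0 * (f y * w x)"
            by (simp add: c0_def algebra_simps)
          finally have "ennreal (1 / m * (f x * w x))
              \<le> ennreal (c0 * K powr (real n + s * p) * k x y + c0 * (f y * w x))"
            by (rule ennreal_leI)
          also have "\<dots> = ennreal (c0 * K powr (real n + s * p)) * ennreal (k x y)
              + ennreal c0 * (ennreal (f y) * ennreal (w x))"
            using nn c0 by (simp add: ennreal_mult)
          finally show ?thesis using G True \<open>y \<in> D\<close> by (simp add: ind_def)
        qed simp
      qed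
      also have "\<dots> = (\<integral>\<^sup>+y. ennreal (c0 * K powr (real n + s * p)) * (ennreal (k x y) * indicator D y * indicator D x) \<partial>lborel)
          + (\<integral>\<^sup>+y. ennreal c0 * (ennreal (f y) * (ennreal (w x) * ind x y)) \<partial>lborel)"
        by (intro nn_integral_add) measurable
      finally show ?thesis using True by simp
    qed simp
    have "I \<le> (\<integral>\<^sup>+x. (\<integral>\<^sup>+y. ennreal (c0 * K powr (real n + s * p)) * (ennreal (k x y) * indicator D y * indicator D x) \<partial>lborel)
          + (\<integral>\<^sup>+y. ennreal c0 * (ennreal (f y) * (ennreal (w x) * ind x y)) \<partial>lborel) \<partial>lborel)"
      unfolding I_def by (intro nn_integral_mono point)
    also have "\<dots> = (\<integral>\<^sup>+x. (\<integral>\<^sup>+y. ennreal (c0 * K powr (real n + s * p)) * (ennreal (k x y) * indicator D y * indicator D x) \<partial>lborel) \<partial>lborel)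
          + (\<integral>\<^sup>+x. (\<integral>\<^sup>+y. ennreal c0 * (ennreal (f y) * (ennreal (w x) * ind x y)) \<partial>lborel) \<partial>lborel)"
      by (intro nn_integral_add) measurable
    also have "(\<integral>\<^sup>+x. (\<integral>\<^sup>+y. ennreal (c0 * K powr (real n + s * p)) * (ennreal (k x y) * indicator D y * indicator D x) \<partial>lborel) \<partial>lborel)
        = ennreal (c0 * K powr (real n + s * p)) * J"
      unfolding J_def by (simp add: nn_integral_cmult nn_integral_multc)
    also have "(\<integral>\<^sup>+x. (\<integral>\<^sup>+y. ennreal c0 * (ennreal (f y) * (ennreal (w x) * ind x y)) \<partial>lborel) \<partial>lborel)
        = (\<integral>\<^sup>+y. (\<integral>\<^sup>+x. ennreal c0 * (ennreal (f y) * (ennreal (w x) * ind x y)) \<partial>lborel) \<partial>lborel)"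
      by (rule lborel_pair.Fubini') measurable
    also have "\<dots> \<le> (\<integral>\<^sup>+y. ennreal (1/2) * (ennreal (f y * \<delta> y powr \<gamma>) * indicator D y) \<partial>lborel)"
    proof (intro nn_integral_mono)
      fix y
      show "(\<integral>\<^sup>+x. ennreal c0 * (ennreal (f y) * (ennreal (w x) * ind x y)) \<partial>lborel)
          \<le> ennreal (1/2) * (ennreal (f y * \<delta> y powr \<gamma>) * indicator D y)"
      proof (cases "y \<in> D")
        case True
        have "(\<integral>\<^sup>+x. ennreal c0 * (ennreal (f y) * (ennreal (w x) * ind x y)) \<partial>lborel)
          = ennreal c0 * (ennreal (f y) * (\<integral>\<^sup>+x. ennreal (w x) * ind x y \<partial>lborel))"
          by (simp add: nn_integral_cmult)
        also have "(\<integral>\<^sup>+x. ennreal (w x) * ind x y \<partial>lborel)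
          = (\<integral>\<^sup>+x\<in>{x. (x, y) \<in> \<Gamma>}. ennreal (bdist D x powr (\<beta> - s * p - real DIM('a))) \<partial>lborel)"
          by (intro nn_integral_cong) (auto simp: ind_def w_def \<gamma>_def \<delta>_def n_def indicator_def)
        also have "ennreal c0 * (ennreal (f y) * \<dots>)
          \<le> ennreal c0 * (ennreal (f y) * ennreal (m * (2 powr - p / 2) * \<delta> y powr \<gamma>))"
          using thin[OF True] by (intro mult_left_mono) (auto simp: \<delta>_def \<gamma>_def)
        also have "\<dots> = ennreal (c0 * (f y * (m * (2 powr - p / 2) * \<delta> y powr \<gamma>)))"
          using c0 nn \<open>0 < m\<close> by (simp add: ennreal_mult[symmetric])
        also have "c0 * (f y * (m * (2 powr - p / 2) * \<delta> y powr \<gamma>)) = 1/2 * (f y * \<delta> y powr \<gamma>)"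
          using \<open>0 < m\<close> by (simp add: c0_def powr_minus field_simps)
        also have "ennreal \<dots> = ennreal (1/2) * ennreal (f y * \<delta> y powr \<gamma>)"
          by (rule ennreal_mult') simp
        finally show ?thesis using True by simp
      next
        case False
        then have "ind x y = 0" for x using sub by (auto simp: ind_def indicator_def)
        then show ?thesis by simp
      qed
    qed
    also have "\<dots> = ennreal (1/2) * I"
      unfolding I_def by (intro nn_integral_cmult) measurable
    finally have "I \<le> ennreal (c0 * K powr (real n + s * p)) * J + ennreal (1/2) * I"
      by (simp add: add_left_mono)
    moreover have "I < \<infinity>"
      unfolding I_def f_def \<delta>_def using weighted_norm_finite[OF assms(1-3) u] .
    ultimately have "I \<le> 2 * (ennreal (c0 * K powr (real n + s * p)) * J)"
      by (rule le_of_le_half_add)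
    also have "\<dots> = ennreal c * J"
      using c0 by (simp add: c_def ennreal_mult mult.assoc)
    finally have "I \<le> ennreal c * J" .
    moreover have "I = (\<integral>\<^sup>+x\<in>D. ennreal (\<bar>u x\<bar> powr p / \<delta> x powr (s * p) * \<delta> x powr \<beta>) \<partial>lborel)"
      unfolding I_def f_def \<gamma>_def by (simp add: powr_diff)
    ultimately show ?thesis unfolding J_def k_def by simp
  qed
  ultimately show ?thesis unfolding admits_Hardy_def \<delta>_def n_def
    by (intro exI[of _ c] conjI ballI)
qed


section \<open>Covering and separation\<close>

text \<open>The dimension only speaks of radii below twice the diameter. The covering bound extends to all
  radii: beyond that range a ball \<open>ball x R\<close> contains nothing new of \<open>E\<close>, so a smaller
  admissible radius does as well, unless \<open>r\<close> is so large that one ball suffices.\<close>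

lemma upper_assouad_dim_lessE:
  fixes E :: "'a::euclidean_space set"
  assumes "upper_assouad_dim E < ereal t"
  obtains a C where "a < t" "0 < C"
    "\<And>r R x. 0 < r \<Longrightarrow> r < R \<Longrightarrow> x \<in> E \<Longrightarrow> \<exists>F. finite F \<and>
       ball x R \<inter> E \<subseteq> (\<Union>y\<in>F. ball y r) \<and> real (card F) \<le> C * (R / r) powr a"
proof -
  obtain a C where "a < t" "0 \<le> a" "0 < C" and cov:
    "\<And>r R x. 0 < r \<Longrightarrow> r < R \<Longrightarrow> ereal R < 2 * ediam E \<Longrightarrow> x \<in> E \<Longrightarrow> \<exists>F. finite F \<and>
       F \<subseteq> E \<and> ball x R \<inter> E \<subseteq> (\<Union>y\<in>F. ball y r) \<and> real (card F) \<le> C * (R / r) powr a"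
    using assms unfolding upper_assouad_dim_def Inf_less_iff by auto
  have "\<exists>F. finite F \<and> ball x R \<inter> E \<subseteq> (\<Union>y\<in>F. ball y r) \<and>
      real (card F) \<le> max C 1 * (R / r) powr a" if r: "0 < r" "r < R" and "x \<in> E" for r R x
  proof -
    have one: "1 \<le> (R / r) powr a" using r \<open>0 \<le> a\<close> by (intro ge_one_powr_ge_zero) auto
    consider "ereal R < 2 * ediam E" | "bounded E" "2 * diameter E \<le> R"
    proof (cases "bounded E")
      case True
      then have "2 * ediam E = ereal (2 * diameter E)" by (simp add: ediam_def)
      then show ?thesis using that True by (cases "R < 2 * diameter E") auto
    next
      case False then show ?thesis using that by (simp add: ediam_def)
    qed
    then show ?thesis
    proof cases
      case 1
      from cov[OF r 1 \<open>x \<in> E\<close>] obtain F where F: "finite F" "ball x R \<inter> E \<subseteq> (\<Union>y\<in>F. ball y r)"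
        "real (card F) \<le> C * (R / r) powr a" by blast
      then have "real (card F) \<le> max C 1 * (R / r) powr a"
        by (meson max.cobounded1 mult_right_mono order_trans powr_ge_zero)
      with F show ?thesis by blast
    next
      case 2
      have diam: "dist x e \<le> diameter E" if "e \<in> E" for e
        using 2 \<open>x \<in> E\<close> that by (simp add: diameter_bounded_bound)
      show ?thesis
      proof (cases "diameter E < r")
        case True
        then have "ball x R \<inter> E \<subseteq> (\<Union>y\<in>{x}. ball y r)" using diam by fastforce
        moreover have "real (card {x}) \<le> max C 1 * (R / r) powr a"
          using mult_mono[OF max.cobounded2[of 1 C] one] by simp
        ultimately show ?thesis by blast
      next
        case False
        \<comment> \<open>Any radius strictly between one and two diameters is admissible and sees all of \<open>E\<close>.\<close>
        let ?R = "3 / 2 * diameter E"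
        have R: "r < ?R" "?R < 2 * diameter E" "?R \<le> R" using False 2 r by auto
        then have "ereal ?R < 2 * ediam E" using 2 by (simp add: ediam_def)
        from cov[OF r(1) R(1) this \<open>x \<in> E\<close>] obtain F where
          F: "finite F" "ball x ?R \<inter> E \<subseteq> (\<Union>y\<in>F. ball y r)"
            "real (card F) \<le> C * (?R / r) powr a" by blast
        have "dist x e < ?R" if "e \<in> E" for e using diam[OF that] R r by auto
        then have "ball x R \<inter> E \<subseteq> ball x ?R \<inter> E" by auto
        moreover have "C * (?R / r) powr a \<le> max C 1 * (R / r) powr a"
          using R r \<open>0 \<le> a\<close> \<open>0 < C\<close>
          by (intro mult_mono powr_mono2 divide_right_mono) auto
        ultimately show ?thesis using F by (meson order_trans)
      qed
    qed
  qed
  with \<open>a < t\<close> show ?thesis by (intro that[of a "max C 1"]) auto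
qed

text \<open>A separated set of maximal cardinality is a cover, since an uncovered point could be added.\<close>

lemma exists_large_separated_set:
  fixes A :: "'a::metric_space set"
  assumes "0 < r"
    and cover: "\<And>F. finite F \<Longrightarrow> F \<subseteq> A \<Longrightarrow> A \<subseteq> (\<Union>y\<in>F. ball y r) \<Longrightarrow> N \<le> real (card F)"
  shows "\<exists>P. finite P \<and> P \<subseteq> A \<and> (\<forall>y\<in>P. \<forall>z\<in>P. y \<noteq> z \<longrightarrow> r \<le> dist y z) \<and> N \<le> real (card P)"
proof (rule ccontr)
  define sep where "sep P \<longleftrightarrow> finite P \<and> P \<subseteq> A \<and> (\<forall>y\<in>P. \<forall>z\<in>P. y \<noteq> z \<longrightarrow> r \<le> dist y z)" for P
  assume "\<not> ?thesis"
  then have small: "real (card P) < N" if "sep P" for P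
    using that unfolding sep_def by (meson not_le)
  have "sep {}" by (simp add: sep_def)
  moreover have "\<forall>P. sep P \<longrightarrow> card P < nat \<lceil>N\<rceil>"
    using small by (metis less_ceiling_iff of_int_of_nat_eq zless_nat_eq_int_zless)
  ultimately obtain P where P: "sep P" and max: "\<And>Q. sep Q \<Longrightarrow> card Q \<le> card P"
    using Lattices_Big.ex_has_greatest_nat[of sep "{}" card "nat \<lceil>N\<rceil>"] by auto
  have "A \<subseteq> (\<Union>y\<in>P. ball y r)"
  proof (rule ccontr)
    assume "\<not> ?thesis"
    then obtain e where e: "e \<in> A" "\<And>y. y \<in> P \<Longrightarrow> r \<le> dist y e"
      by (force simp: not_less)
    have "e \<notin> P" using e(2)[of e] \<open>0 < r\<close> by auto
    moreover have "sep (insert e P)" using P e by (auto simp: sep_def dist_commute)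
    ultimately show False using max[of "insert e P"] P by (simp add: sep_def)
  qed
  then have "N \<le> real (card P)" using P cover[of P] unfolding sep_def by simp
  with small[OF P] show False by simp
qed

lemma lower_assouad_dim_greaterE:
  fixes E :: "'a::euclidean_space set"
  assumes "ereal t < lower_assouad_dim E"
  obtains a C where "t < a" "0 < C"
    "\<And>r R x. 0 < r \<Longrightarrow> r < R \<Longrightarrow> ereal R < 2 * ediam E \<Longrightarrow> x \<in> E \<Longrightarrow> \<exists>P. finite P \<and>
       P \<subseteq> ball x R \<inter> E \<and> (\<forall>y\<in>P. \<forall>z\<in>P. y \<noteq> z \<longrightarrow> r \<le> dist y z) \<and> C * (R / r) powr a \<le> real (card P)"
proof -
  obtain a C where aC: "t < a" "0 < C" and cov:
    "\<And>r R x F. 0 < r \<Longrightarrow> r < R \<Longrightarrow> ereal R < 2 * ediam E \<Longrightarrow> x \<in> E \<Longrightarrow> finite F \<Longrightarrow>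
       F \<subseteq> E \<Longrightarrow> ball x R \<inter> E \<subseteq> (\<Union>y\<in>F. ball y r) \<Longrightarrow> C * (R / r) powr a \<le> real (card F)"
    using assms unfolding lower_assouad_dim_def less_Sup_iff by auto
  show ?thesis
  proof (rule that[OF aC])
    fix r R x assume *: "0 < r" "r < R" "ereal R < 2 * ediam E" "x \<in> E"
    show "\<exists>P. finite P \<and> P \<subseteq> ball x R \<inter> E \<and>
        (\<forall>y\<in>P. \<forall>z\<in>P. y \<noteq> z \<longrightarrow> r \<le> dist y z) \<and> C * (R / r) powr a \<le> real (card P)"
      by (intro exists_large_separated_set *(1) cov[OF *]) auto
  qed
qed

section \<open>Volume estimates\<close>

lemma borel_sections:
  fixes \<Gamma> :: "('a::euclidean_space \<times> 'a) set"
  assumes "\<Gamma> \<in> sets borel"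
  shows "{y. (x, y) \<in> \<Gamma>} \<in> sets borel" "{x. (x, y) \<in> \<Gamma>} \<in> sets borel"
proof -
  have \<Gamma>: "\<Gamma> \<in> sets (borel \<Otimes>\<^sub>M borel)" using assms by (subst borel_prod)
  show "{y. (x, y) \<in> \<Gamma>} \<in> sets borel" using sets_Pair1[OF \<Gamma>, of x] by (simp add: vimage_def)
  show "{x. (x, y) \<in> \<Gamma>} \<in> sets borel" using sets_Pair2[OF \<Gamma>, of y] by (simp add: vimage_def)
qed

text \<open>Balls of radius \<open>r\<close> that cover a piece of \<open>E\<close> cover, when their radius is doubled, all points
  at distance less than \<open>r\<close> from that piece. The cover has to reach \<open>r\<close> beyond \<open>R\<close> because
  the point of \<open>E\<close> closest to \<open>x\<close> may lie that much further from \<open>w\<close> than \<open>x\<close>.\<close>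

lemma emeasure_boundary_layer_le:
  fixes E F S :: "'a::euclidean_space set"
  assumes "finite F" "ball w (R + r) \<inter> E \<subseteq> (\<Union>y\<in>F. ball y r)" "real (card F) \<le> N" "0 \<le> r"
    and "\<And>x. x \<in> S \<Longrightarrow> dist w x \<le> R" "\<And>x. x \<in> S \<Longrightarrow> \<exists>e\<in>E. dist x e < r"
  shows "emeasure lborel S \<le> ennreal (N * (unit_ball_vol (real DIM('a)) * (2 * r) ^ DIM('a)))"
proof -
  have "S \<subseteq> (\<Union>y\<in>F. ball y (2 * r))"
  proof
    fix x assume "x \<in> S"
    then obtain e where e: "e \<in> E" "dist x e < r" using assms by blast
    have "dist w e < R + r"
      using assms(5)[OF \<open>x \<in> S\<close>] e dist_triangle[of w e x] by linarith
    then obtain y where y: "y \<in> F" "dist y e < r" using assms(2) e by fastforce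
    have "dist y x < 2 * r"
      using dist_triangle[of y x e] y e by (simp add: dist_commute)
    with y show "x \<in> (\<Union>y\<in>F. ball y (2 * r))" by auto
  qed
  then have "emeasure lborel S \<le> emeasure lborel (\<Union>y\<in>F. ball y (2 * r))"
    using \<open>finite F\<close> by (intro emeasure_mono) auto
  also have "\<dots> \<le> (\<Sum>y\<in>F. emeasure lborel (ball y (2 * r)))"
    using \<open>finite F\<close> by (intro emeasure_subadditive_finite) auto
  also have "\<dots> = ennreal (real (card F) * (unit_ball_vol (real DIM('a)) * (2 * r) ^ DIM('a)))"
    using \<open>0 \<le> r\<close> by (simp add: emeasure_ball ennreal_mult ennreal_of_nat_eq_real_of_nat)
  also have "\<dots> \<le> ennreal (N * (unit_ball_vol (real DIM('a)) * (2 * r) ^ DIM('a)))"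
    using assms by (intro ennreal_leI mult_right_mono) auto
  finally show ?thesis .
qed

lemma emeasure_disjoint_balls_ge:
  fixes z :: "'b \<Rightarrow> 'a::euclidean_space"
  assumes "finite P" "N \<le> real (card P)" "0 \<le> r" "S \<in> sets borel"
    and "\<And>e. e \<in> P \<Longrightarrow> ball (z e) r \<subseteq> S" "disjoint_family_on (\<lambda>e. ball (z e) r) P"
  shows "ennreal (N * (unit_ball_vol (real DIM('a)) * r ^ DIM('a))) \<le> emeasure lborel S"
proof -
  have "ennreal (N * (unit_ball_vol (real DIM('a)) * r ^ DIM('a)))
      \<le> ennreal (real (card P) * (unit_ball_vol (real DIM('a)) * r ^ DIM('a)))"
    using assms by (intro ennreal_leI mult_right_mono) auto
  also have "\<dots> = (\<Sum>e\<in>P. emeasure lborel (ball (z e) r))"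
    using \<open>0 \<le> r\<close> by (simp add: emeasure_ball ennreal_mult ennreal_of_nat_eq_real_of_nat)
  also have "\<dots> = emeasure lborel (\<Union>e\<in>P. ball (z e) r)"
    using assms by (intro sum_emeasure) auto
  also have "\<dots> \<le> emeasure lborel S"
    using assms by (intro emeasure_mono) auto
  finally show ?thesis .
qed

text \<open>The sum of the powers of \<open>a\<close> and \<open>b\<close> covers both signs of the exponent \<open>e\<close>.\<close>

lemma nn_integral_powr_le:
  fixes g :: "'a::euclidean_space \<Rightarrow> real"
  assumes "0 < a" "0 < b" "0 < t" and S: "S \<in> sets borel"
    and g: "\<And>x. x \<in> S \<Longrightarrow> a * t \<le> g x \<and> g x \<le> b * t"
    and V: "emeasure lborel S \<le> ennreal V"
  shows "(\<integral>\<^sup>+x\<in>S. ennreal (g x powr e) \<partial>lborel) \<le> ennreal ((a powr e + b powr e) * t powr e * V)"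
proof -
  have "(\<integral>\<^sup>+x\<in>S. ennreal (g x powr e) \<partial>lborel)
      \<le> (\<integral>\<^sup>+x. ennreal ((a powr e + b powr e) * t powr e) * indicator S x \<partial>lborel)"
  proof (intro nn_integral_mono)
    fix x
    have "g x powr e \<le> (a powr e + b powr e) * t powr e" if "x \<in> S"
    proof (cases "0 \<le> e")
      case True
      then have "g x powr e \<le> (b * t) powr e"
        using g[OF that] assms by (intro powr_mono2) (auto intro: order_trans[rotated])
      then show ?thesis by (simp add: powr_mult distrib_right add_increasing)
    next
      case False
      then have "g x powr e \<le> (a * t) powr e"
        using g[OF that] assms by (intro powr_mono2') auto
      then show ?thesis by (simp add: powr_mult distrib_right add_increasing2)
    qed
    then show "ennreal (g x powr e) * indicator S x
        \<le> ennreal ((a powr e + b powr e) * t powr e) * indicator S x"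
      by (cases "x \<in> S") (simp_all add: ennreal_leI)
  qed
  also have "\<dots> = ennreal ((a powr e + b powr e) * t powr e) * emeasure lborel S"
    using S by (intro nn_integral_cmult_indicator) simp
  also have "\<dots> \<le> ennreal ((a powr e + b powr e) * t powr e) * ennreal V"
    using V by (rule mult_left_mono) simp
  finally show ?thesis by (simp add: ennreal_mult')
qed

lemma exists_scale:
  fixes A B e :: real
  assumes "e < 0" "0 < B"
  obtains M where "2 \<le> M" "A * M powr e \<le> B"
proof -
  have "((\<lambda>M. A * M powr e) \<longlongrightarrow> A * 0) at_top"
    using assms by (intro tendsto_mult tendsto_const tendsto_neg_powr filterlim_ident)
  then have "eventually (\<lambda>M. A * M powr e < B) at_top"
    using \<open>0 < B\<close> by (intro order_tendstoD(2)[where y="A * 0"]) auto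
  then have "eventually (\<lambda>M. A * M powr e < B \<and> 2 \<le> M) at_top"
    using eventually_ge_at_top by (rule eventually_conj)
  then obtain M where "A * M powr e < B \<and> 2 \<le> M"
    by (metis (no_types, lifting) eventually_happens trivial_limit_at_top_linorder)
  with that show ?thesis by auto
qed

section \<open>Thin and fat boundaries\<close>

text \<open>Moving away from the boundary. A ball of radius \<open>\<kappa> * M * \<delta> x\<close> in \<open>D\<close> is halved, so that on
  the smaller ball the distance to the complement is still of order \<open>M * \<delta> x\<close>. In the
  reverse direction, \<open>\<delta> x\<close> is comparable to \<open>t = \<delta> y / M\<close>, which yields the layer whose volume
  the covering controls.\<close>

theorem Hardy_thin_boundary:
  fixes D :: "'a::euclidean_space set" and \<kappa> s p \<beta> :: real
  assumes "0 < \<kappa>" "\<kappa> < 1" "0 < p" "0 \<le> real DIM('a) + s * p"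
    and "open D" "D \<noteq> UNIV" "plump \<kappa> D" "\<not> bounded D"
    and "upper_assouad_dim (frontier D) < ereal (real DIM('a) - s * p + \<beta>)"
  shows "admits_Hardy s p \<beta> D"
proof -
  define n where "n = DIM('a)"
  define \<gamma> where "\<gamma> = \<beta> - s * p"
  define \<omega> where "\<omega> = unit_ball_vol (real n)"
  have "0 < \<omega>" by (simp add: \<omega>_def)
  obtain a C where aC: "a < real DIM('a) - s * p + \<beta>" "0 < C" and
    cover: "\<And>r R x. 0 < r \<Longrightarrow> r < R \<Longrightarrow> x \<in> frontier D \<Longrightarrow> \<exists>F. finite F \<and>
       ball x R \<inter> frontier D \<subseteq> (\<Union>y\<in>F. ball y r) \<and> real (card F) \<le> C * (R / r) powr a"
    using upper_assouad_dim_lessE[OF assms(9)] by metis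
  define c1 where "c1 = (1/3) powr (\<gamma> - real n) + (2 / \<kappa>) powr (\<gamma> - real n)"
  \<comment> \<open>\<open>A\<close> and \<open>B\<close> collect what does not depend on the scale \<open>M\<close>.\<close>
  define A where "A = c1 * C * 4 powr a * \<omega> * (6 / \<kappa>) ^ n"
  define B where "B = \<omega> * (\<kappa> / 2) ^ n * (2 powr - p / 2)"
  have "0 < B" using \<open>0 < \<omega>\<close> \<open>0 < \<kappa>\<close> by (simp add: B_def)
  moreover have "a - \<gamma> - real n < 0" using aC by (simp add: \<gamma>_def n_def)
  ultimately obtain M where M: "2 \<le> M" "A * M powr (a - \<gamma> - real n) \<le> B"
    using exists_scale by metis
  define \<delta> where "\<delta> = bdist D"
  have pos: "0 < \<delta> x \<longleftrightarrow> x \<in> D" for x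
    using bdist_pos_iff[of D x] assms by (simp add: \<delta>_def)
  define \<Gamma> where "\<Gamma> = {q. dist (fst q) (snd q) \<le> 2 * M * \<delta> (fst q)}
    \<inter> {q. \<kappa> * M / 2 * \<delta> (fst q) \<le> \<delta> (snd q)} \<inter> D \<times> D"
  have meas: "\<Gamma> \<in> sets borel"
    unfolding \<Gamma>_def \<delta>_def bdist_def using \<open>open D\<close>
    by (intro sets.Int borel_closed borel_open closed_Collect_le continuous_intros open_Times)
  show ?thesis
  proof (rule Hardy_of_averaging[OF \<open>open D\<close> \<open>D \<noteq> UNIV\<close> \<open>0 < p\<close> assms(4), of "\<omega> * (\<kappa> * M / 2) ^ n" "2 * M" \<Gamma>])
    show "0 < \<omega> * (\<kappa> * M / 2) ^ n" "0 < 2 * M" using M \<open>0 < \<omega>\<close> \<open>0 < \<kappa>\<close> by auto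
    show "\<Gamma> \<in> sets borel" by (fact meas)
    show "\<Gamma> \<subseteq> D \<times> D" by (auto simp: \<Gamma>_def)
    show "dist x y \<le> 2 * M * bdist D x" if "(x, y) \<in> \<Gamma>" for x y
      using that by (simp add: \<Gamma>_def \<delta>_def)
    show "ennreal (\<omega> * (\<kappa> * M / 2) ^ n * bdist D x ^ DIM('a)) \<le> emeasure lborel {y. (x, y) \<in> \<Gamma>}"
      if "x \<in> D" for x
    proof -
      have x: "0 < \<delta> x" using that pos by simp
      have "x \<in> closure D" using that closure_subset by blast
      moreover have "0 < M * \<delta> x" using M x by simp
      moreover have "ereal (M * \<delta> x) < ediam D" using assms by (simp add: ediam_def)
      ultimately obtain z where z: "dist x z \<le> M * \<delta> x" "ball z (\<kappa> * (M * \<delta> x)) \<subseteq> D"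
        using \<open>plump \<kappa> D\<close> unfolding plump_def by (meson mem_cball)
      let ?r = "\<kappa> * M / 2 * \<delta> x"
      have "ball z ?r \<subseteq> {y. (x, y) \<in> \<Gamma>}"
      proof
        fix y assume "y \<in> ball z ?r"
        then have y: "dist z y < ?r" by simp
        have "?r \<le> \<delta> y"
          using bdist_ge_of_ball_subset[OF z(2) \<open>D \<noteq> UNIV\<close>, of y] y
          by (simp add: \<delta>_def dist_commute)
        moreover have "0 < ?r" using M x \<open>0 < \<kappa>\<close> by simp
        ultimately have "y \<in> D" using pos by (metis less_le_trans)
        have "\<kappa> * (M * \<delta> x) \<le> 1 * (M * \<delta> x)"
          using \<open>0 < M * \<delta> x\<close> \<open>\<kappa> < 1\<close> by (intro mult_right_mono) auto
        then have "dist x y \<le> 2 * M * \<delta> x"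
          using dist_triangle[of x y z] z(1) y \<open>0 < M * \<delta> x\<close> by simp
        with \<open>?r \<le> \<delta> y\<close> \<open>y \<in> D\<close> that show "y \<in> {y. (x, y) \<in> \<Gamma>}" by (simp add: \<Gamma>_def)
      qed
      then have "emeasure lborel (ball z ?r) \<le> emeasure lborel {y. (x, y) \<in> \<Gamma>}"
        using borel_sections[OF meas] by (intro emeasure_mono) auto
      moreover have "0 \<le> ?r" using M x \<open>0 < \<kappa>\<close> by simp
      ultimately have "ennreal (\<omega> * ?r ^ n) \<le> emeasure lborel {y. (x, y) \<in> \<Gamma>}"
        by (simp only: emeasure_ball \<omega>_def n_def)
      moreover have "\<omega> * ?r ^ n = \<omega> * (\<kappa> * M / 2) ^ n * bdist D x ^ DIM('a)"
        by (simp only: power_mult_distrib mult.assoc \<delta>_def n_def)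
      ultimately show ?thesis by (simp only:)
    qed
    show "(\<integral>\<^sup>+x\<in>{x. (x, y) \<in> \<Gamma>}. ennreal (bdist D x powr (\<beta> - s * p - real DIM('a))) \<partial>lborel)
        \<le> ennreal (\<omega> * (\<kappa> * M / 2) ^ n * (2 powr - p / 2) * bdist D y powr (\<beta> - s * p))"
      if "y \<in> D" for y
    proof -
      define t where "t = \<delta> y / M"
      have t: "0 < t" "\<delta> y = M * t" using that pos M by (auto simp: t_def)
      obtain w where w: "w \<in> frontier D" "dist y w = \<delta> y"
        using nearest_frontier_point[OF \<open>open D\<close> \<open>D \<noteq> UNIV\<close> \<open>y \<in> D\<close>] unfolding \<delta>_def by metis
      let ?r = "3 * t / \<kappa>" and ?R = "6 * M * t / \<kappa>"
      have r: "0 < ?r" using t \<open>0 < \<kappa>\<close> by simp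
      have rR: "?r \<le> ?R" using t \<open>0 < \<kappa>\<close> M by (intro divide_right_mono mult_right_mono) auto
      with r have "?r < 2 * ?R" by linarith
      from cover[OF r this w(1)] obtain F where F: "finite F"
        "ball w (2 * ?R) \<inter> frontier D \<subseteq> (\<Union>y\<in>F. ball y ?r)" "real (card F) \<le> C * (2 * ?R / ?r) powr a"
        by blast
      have "2 * ?R / ?r = 4 * M" using t \<open>0 < \<kappa>\<close> by (simp add: field_simps)
      with F have card: "real (card F) \<le> C * (4 * M) powr a" by simp
      have bounds: "t / 3 \<le> \<delta> x \<and> \<delta> x \<le> 2 / \<kappa> * t \<and> dist w x \<le> ?R" if "(x, y) \<in> \<Gamma>" for x
      proof -
        have x: "dist x y \<le> 2 * M * \<delta> x" "\<kappa> * M / 2 * \<delta> x \<le> M * t" "x \<in> D"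
          using that t by (auto simp: \<Gamma>_def)
        have "\<kappa> * \<delta> x \<le> 2 * t" using x(2) M by (simp add: field_simps)
        then have up: "\<delta> x \<le> 2 / \<kappa> * t" using \<open>0 < \<kappa>\<close> by (simp add: field_simps)
        have "M * t \<le> \<delta> x + dist x y"
          using bdist_le_add_dist[of D y x] t by (simp add: \<delta>_def dist_commute)
        also have "\<dots> \<le> M * \<delta> x + 2 * M * \<delta> x"
          using x M pos[of x] by (intro add_mono) auto
        finally have "M * t \<le> M * (3 * \<delta> x)" by simp
        then have low: "t / 3 \<le> \<delta> x" using M by simp
        have "dist w x \<le> M * t + 2 * M * \<delta> x"
          using dist_triangle[of w x y] w x t by (simp add: dist_commute)
        also have "2 * M * \<delta> x \<le> 2 * M * (2 / \<kappa> * t)" using up M by (intro mult_left_mono) auto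
        also have "M * t \<le> M * t / \<kappa>" using M t \<open>0 < \<kappa>\<close> \<open>\<kappa> < 1\<close> by (simp add: le_divide_eq)
        also have "M * t / \<kappa> + 2 * M * (2 / \<kappa> * t) = 5 * M * t / \<kappa>" by (simp add: field_simps)
        also have "\<dots> \<le> ?R" using M t \<open>0 < \<kappa>\<close> by (intro divide_right_mono mult_right_mono) auto
        finally show ?thesis using up low by simp
      qed
      define V where "V = C * (4 * M) powr a * (\<omega> * (2 * ?r) ^ n)"
      have V: "emeasure lborel {x. (x, y) \<in> \<Gamma>} \<le> ennreal V"
        unfolding V_def \<omega>_def n_def
      proof (rule emeasure_boundary_layer_le[OF F(1) _ card])
        show "ball w (?R + ?r) \<inter> frontier D \<subseteq> (\<Union>y\<in>F. ball y ?r)"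
          using F(2) rR by (force simp: subset_eq)
        show "0 \<le> ?r" using r by simp
        fix x assume "x \<in> {x. (x, y) \<in> \<Gamma>}"
        then have x: "(x, y) \<in> \<Gamma>" by simp
        then show "dist w x \<le> ?R" using bounds by blast
        have "x \<in> D" using x by (simp add: \<Gamma>_def)
        then obtain e where "e \<in> frontier D" "dist x e = \<delta> x"
          using nearest_frontier_point[OF \<open>open D\<close> \<open>D \<noteq> UNIV\<close>] unfolding \<delta>_def by metis
        moreover have "\<delta> x < ?r"
        proof -
          have "\<delta> x \<le> 2 / \<kappa> * t" using bounds[OF x] by simp
          also have "\<dots> < ?r" using t \<open>0 < \<kappa>\<close> by (simp add: field_simps)
          finally show ?thesis .
        qed
        ultimately show "\<exists>e\<in>frontier D. dist x e < ?r" by metis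
      qed
      have "(\<integral>\<^sup>+x\<in>{x. (x, y) \<in> \<Gamma>}. ennreal (\<delta> x powr (\<gamma> - real n)) \<partial>lborel)
          \<le> ennreal (c1 * t powr (\<gamma> - real n) * V)"
        unfolding c1_def using bounds t \<open>0 < \<kappa>\<close> borel_sections[OF meas] V
        by (intro nn_integral_powr_le) auto
      also have "c1 * t powr (\<gamma> - real n) * V = A * M powr a * t powr \<gamma>"
      proof -
        have "t powr (\<gamma> - real n) * t ^ n = t powr \<gamma>"
          using t by (simp add: powr_diff powr_realpow)
        moreover have "(2 * ?r) ^ n = (6 / \<kappa>) ^ n * t ^ n"
          by (simp add: power_mult_distrib[symmetric])
        moreover have "(4 * M) powr a = 4 powr a * M powr a" by (simp add: powr_mult)
        ultimately show ?thesis by (simp add: A_def V_def)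
      qed
      also have "\<dots> = A * M powr (a - \<gamma> - real n) * M ^ n * \<delta> y powr \<gamma>"
        using M t by (simp add: powr_diff powr_realpow powr_mult)
      also have "\<dots> \<le> B * M ^ n * \<delta> y powr \<gamma>"
        using M by (intro mult_right_mono) auto
      also have "\<dots> = \<omega> * (\<kappa> * M / 2) ^ n * (2 powr - p / 2) * \<delta> y powr \<gamma>"
        by (simp add: B_def power_mult_distrib power_divide)
      finally show ?thesis unfolding \<delta>_def \<gamma>_def n_def by (simp add: ennreal_leI)
    qed
  qed
qed

text \<open>Moving towards the boundary. Around each of many boundary points separated by \<open>r = \<delta> x / M\<close>,
  plumpness is used at radius \<open>r / 4\<close>, and the ball obtained is halved. The quarter keeps the halved ball
  within distance \<open>r / 2\<close> of its boundary point, which makes these balls disjoint; the halving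
  keeps them away from the boundary. The hypothesis on boundedness ensures that
  \<open>\<delta> x\<close> and \<open>r / 4\<close> are admissible radii for the dimension and for plumpness.\<close>

theorem Hardy_fat_boundary:
  fixes D :: "'a::euclidean_space set" and \<kappa> s p \<beta> :: real
  assumes "0 < \<kappa>" "\<kappa> < 1" "0 < p" "0 \<le> real DIM('a) + s * p"
    and "open D" "D \<noteq> UNIV" "plump \<kappa> D" "bounded D \<or> \<not> bounded (frontier D)"
    and "ereal (real DIM('a) - s * p + \<beta>) < lower_assouad_dim (frontier D)"
  shows "admits_Hardy s p \<beta> D"
proof -
  define n where "n = DIM('a)"
  define \<gamma> where "\<gamma> = \<beta> - s * p"
  define \<omega> where "\<omega> = unit_ball_vol (real n)"
  have "0 < \<omega>" by (simp add: \<omega>_def)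
  obtain a C where aC: "real DIM('a) - s * p + \<beta> < a" "0 < C" and
    sep: "\<And>r R x. 0 < r \<Longrightarrow> r < R \<Longrightarrow> ereal R < 2 * ediam (frontier D) \<Longrightarrow> x \<in> frontier D \<Longrightarrow>
       \<exists>P. finite P \<and> P \<subseteq> ball x R \<inter> frontier D \<and> (\<forall>y\<in>P. \<forall>z\<in>P. y \<noteq> z \<longrightarrow> r \<le> dist y z)
         \<and> C * (R / r) powr a \<le> real (card P)"
    using lower_assouad_dim_greaterE[OF assms(9)] by metis
  define A where "A = (1 powr (\<gamma> - real n) + (8 / \<kappa>) powr (\<gamma> - real n)) * \<omega> * (24 / \<kappa>) ^ n"
  define B where "B = C * \<omega> * (\<kappa> / 8) ^ n * (2 powr - p / 2)"
  have "0 < B" using \<open>0 < \<omega>\<close> \<open>0 < \<kappa>\<close> \<open>0 < C\<close> by (simp add: B_def)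
  moreover have "\<gamma> + real n - a < 0" using aC by (simp add: \<gamma>_def n_def)
  ultimately obtain M where M: "2 \<le> M" "A * M powr (\<gamma> + real n - a) \<le> B"
    using exists_scale by metis
  define \<delta> where "\<delta> = bdist D"
  have pos: "0 < \<delta> x \<longleftrightarrow> x \<in> D" for x
    using bdist_pos_iff[of D x] assms by (simp add: \<delta>_def)
  \<comment> \<open>The radius of a halved plump ball, in units of \<open>\<delta> x\<close>.\<close>
  define h where "h = \<kappa> / (8 * M)"
  have h: "0 < h" "8 * M * h = \<kappa>" using M \<open>0 < \<kappa>\<close> by (auto simp: h_def)
  define \<Gamma> where "\<Gamma> = {q. dist (fst q) (snd q) \<le> 3 * \<delta> (fst q)}
    \<inter> {q. h * \<delta> (fst q) \<le> \<delta> (snd q)} \<inter> {q. M * \<delta> (snd q) \<le> \<delta> (fst q)} \<inter> D \<times> D"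
  have meas: "\<Gamma> \<in> sets borel"
    unfolding \<Gamma>_def \<delta>_def bdist_def using \<open>open D\<close>
    by (intro sets.Int borel_closed borel_open closed_Collect_le continuous_intros open_Times)
  define m where "m = C * M powr a * (\<omega> * h ^ n)"
  show ?thesis
  proof (rule Hardy_of_averaging[OF \<open>open D\<close> \<open>D \<noteq> UNIV\<close> \<open>0 < p\<close> assms(4), of m 3 \<Gamma>])
    show "0 < m" using M \<open>0 < \<omega>\<close> h \<open>0 < C\<close> by (simp add: m_def)
    show "(0::real) < 3" by simp
    show "\<Gamma> \<in> sets borel" by (fact meas)
    show "\<Gamma> \<subseteq> D \<times> D" by (auto simp: \<Gamma>_def)
    show "dist x y \<le> 3 * bdist D x" if "(x, y) \<in> \<Gamma>" for x y
      using that by (simp add: \<Gamma>_def \<delta>_def)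
    show "ennreal (m * bdist D x ^ DIM('a)) \<le> emeasure lborel {y. (x, y) \<in> \<Gamma>}"
      if "x \<in> D" for x
    proof -
      have x: "0 < \<delta> x" using that pos by simp
      define r where "r = \<delta> x / M"
      have r: "0 < r" "\<delta> x = M * r" "r < \<delta> x" using x M by (auto simp: r_def field_simps)
      obtain w where w: "w \<in> frontier D" "dist x w = \<delta> x"
        using nearest_frontier_point[OF \<open>open D\<close> \<open>D \<noteq> UNIV\<close> \<open>x \<in> D\<close>] unfolding \<delta>_def by metis
      have small: "ereal (\<delta> x) < 2 * ediam (frontier D)" "ereal (r / 4) < ediam D"
      proof -
        have bf: "bounded (frontier D)" if "bounded D"
          using that by (auto simp: frontier_def intro: bounded_subset[OF bounded_closure])
        show "ereal (\<delta> x) < 2 * ediam (frontier D)"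
          using bdist_le_diameter_frontier[OF \<open>open D\<close> _ that] assms(8) x bf
          by (cases "bounded D") (auto simp: ediam_def \<delta>_def)
        have "r / 4 < diameter D" if "bounded D"
          using bdist_le_diameter[OF \<open>open D\<close> that \<open>x \<in> D\<close>] r unfolding \<delta>_def by linarith
        then show "ereal (r / 4) < ediam D" by (simp add: ediam_def)
      qed
      obtain P where P: "finite P" "P \<subseteq> ball w (\<delta> x) \<inter> frontier D"
        "\<And>e e'. e \<in> P \<Longrightarrow> e' \<in> P \<Longrightarrow> e \<noteq> e' \<Longrightarrow> r \<le> dist e e'"
        "C * (\<delta> x / r) powr a \<le> real (card P)"
        using sep[OF r(1,3) small(1) w(1)] by blast
      have "\<exists>z. dist e z \<le> r / 4 \<and> ball z (\<kappa> * (r / 4)) \<subseteq> D" if "e \<in> P" for e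
        using \<open>plump \<kappa> D\<close> small(2) r that P(2) unfolding plump_def
        by (metis Int_iff frontier_def DiffD1 mem_cball subsetD divide_pos_pos zero_less_numeral)
      then obtain z where z: "\<And>e. e \<in> P \<Longrightarrow> dist e (z e) \<le> r / 4"
          "\<And>e. e \<in> P \<Longrightarrow> ball (z e) (\<kappa> * (r / 4)) \<subseteq> D" by metis
      have \<rho>: "h * \<delta> x = \<kappa> * r / 8" using r M by (simp add: h_def)
      have \<kappa>r: "0 < \<kappa> * r" "\<kappa> * r < r" using r \<open>0 < \<kappa>\<close> \<open>\<kappa> < 1\<close> by auto
      \<comment> \<open>At most \<open>r / 4\<close> from \<open>e\<close> to the centre and less than \<open>r / 8\<close> from there to \<open>y\<close>.\<close>
      have near: "dist e y < r / 2" if "e \<in> P" "y \<in> ball (z e) (h * \<delta> x)" for e y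
        using z(1)[OF that(1)] that(2) dist_triangle[of e y "z e"] \<rho> \<kappa>r by simp
      have "ennreal (C * (\<delta> x / r) powr a * (unit_ball_vol (real DIM('a)) * (h * \<delta> x) ^ DIM('a)))
          \<le> emeasure lborel {y. (x, y) \<in> \<Gamma>}"
      proof (rule emeasure_disjoint_balls_ge[OF P(1,4)])
        show "0 \<le> h * \<delta> x" using \<rho> \<kappa>r by simp
        show "{y. (x, y) \<in> \<Gamma>} \<in> sets borel" by (rule borel_sections[OF meas])
        show "disjoint_family_on (\<lambda>e. ball (z e) (h * \<delta> x)) P"
        proof (unfold disjoint_family_on_def, intro ballI impI, rule ccontr)
          fix e e' assume e: "e \<in> P" "e' \<in> P" "e \<noteq> e'"
            and "ball (z e) (h * \<delta> x) \<inter> ball (z e') (h * \<delta> x) \<noteq> {}"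
          then obtain y where "y \<in> ball (z e) (h * \<delta> x)" "y \<in> ball (z e') (h * \<delta> x)" by blast
          then have "dist e e' < r"
            using near e dist_triangle_half_l[of e y r e'] by (simp add: dist_commute)
          with P(3)[OF e] show False by simp
        qed
        show "ball (z e) (h * \<delta> x) \<subseteq> {y. (x, y) \<in> \<Gamma>}" if e: "e \<in> P" for e
        proof
          fix y assume y: "y \<in> ball (z e) (h * \<delta> x)"
          have "e \<notin> D" using P(2) e \<open>open D\<close> by (auto simp: frontier_def interior_open)
          then have "\<delta> y \<le> dist e y" using bdist_le_dist[of e D y] by (simp add: \<delta>_def dist_commute)
          then have up: "M * \<delta> y \<le> \<delta> x" using near[OF e y] r M by simp
          have low: "h * \<delta> x \<le> \<delta> y"
            using bdist_ge_of_ball_subset[OF z(2)[OF e] \<open>D \<noteq> UNIV\<close>, of y] y \<rho>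
            by (simp add: \<delta>_def dist_commute)
          then have "y \<in> D" using pos \<rho> \<kappa>r by (metis divide_pos_pos less_le_trans zero_less_numeral)
          have "dist w e < \<delta> x" using P(2) e by auto
          then have "dist x y \<le> 3 * \<delta> x"
            using dist_triangle[of x y w] dist_triangle[of w y e] near[OF e y] w r by linarith
          with up low \<open>y \<in> D\<close> \<open>x \<in> D\<close> show "y \<in> {y. (x, y) \<in> \<Gamma>}" by (simp add: \<Gamma>_def)
        qed
      qed
      moreover have "\<delta> x / r = M" using r by simp
      ultimately show ?thesis
        by (simp add: m_def \<omega>_def n_def \<delta>_def power_mult_distrib mult.assoc)
    qed
    show "(\<integral>\<^sup>+x\<in>{x. (x, y) \<in> \<Gamma>}. ennreal (bdist D x powr (\<beta> - s * p - real DIM('a))) \<partial>lborel)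
        \<le> ennreal (m * (2 powr - p / 2) * bdist D y powr (\<beta> - s * p))"
      if "y \<in> D" for y
    proof -
      define t where "t = M * \<delta> y"
      have t: "0 < t" using that pos M by (auto simp: t_def)
      have bounds: "1 * t \<le> \<delta> x \<and> \<delta> x \<le> 8 / \<kappa> * t \<and> dist y x \<le> 24 / \<kappa> * t" if "(x, y) \<in> \<Gamma>" for x
      proof -
        have x: "dist x y \<le> 3 * \<delta> x" "h * \<delta> x \<le> \<delta> y" "M * \<delta> y \<le> \<delta> x"
          using that by (auto simp: \<Gamma>_def)
        have "\<delta> x \<le> 8 / \<kappa> * t" using x(2) M \<open>0 < \<kappa>\<close> by (simp add: h_def t_def field_simps)
        with x show ?thesis by (simp add: t_def dist_commute)
      qed
      define V where "V = \<omega> * (24 / \<kappa> * t) ^ n"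
      have "emeasure lborel {x. (x, y) \<in> \<Gamma>} \<le> emeasure lborel (cball y (24 / \<kappa> * t))"
        using bounds by (intro emeasure_mono) auto
      also have "\<dots> = ennreal V"
        using t \<open>0 < \<kappa>\<close> by (simp add: emeasure_cball V_def \<omega>_def n_def)
      finally have V: "emeasure lborel {x. (x, y) \<in> \<Gamma>} \<le> ennreal V" .
      have "(\<integral>\<^sup>+x\<in>{x. (x, y) \<in> \<Gamma>}. ennreal (\<delta> x powr (\<gamma> - real n)) \<partial>lborel)
          \<le> ennreal ((1 powr (\<gamma> - real n) + (8 / \<kappa>) powr (\<gamma> - real n)) * t powr (\<gamma> - real n) * V)"
        using bounds t \<open>0 < \<kappa>\<close> borel_sections[OF meas] V
        by (intro nn_integral_powr_le) auto
      also have "(1 powr (\<gamma> - real n) + (8 / \<kappa>) powr (\<gamma> - real n)) * t powr (\<gamma> - real n) * V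
          = A * t powr \<gamma>"
      proof -
        have "(1 powr (\<gamma> - real n) + (8 / \<kappa>) powr (\<gamma> - real n)) * t powr (\<gamma> - real n) * V
            = A * (t powr (\<gamma> - real n) * t ^ n)"
          unfolding V_def A_def power_mult_distrib by (simp only: mult_ac)
        also have "t powr (\<gamma> - real n) * t ^ n = t powr \<gamma>"
          using t by (simp add: powr_diff powr_realpow)
        finally show ?thesis .
      qed
      also have "\<dots> = A * M powr (\<gamma> + real n - a) * (M powr a / M ^ n) * \<delta> y powr \<gamma>"
        using M by (simp add: powr_diff powr_add powr_realpow powr_mult t_def)
      also have "\<dots> \<le> B * (M powr a / M ^ n) * \<delta> y powr \<gamma>"
        using M by (intro mult_right_mono) auto
      also have "\<dots> = m * (2 powr - p / 2) * \<delta> y powr \<gamma>"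
        by (simp add: B_def m_def h_def power_mult_distrib power_divide mult_ac)
      finally show ?thesis unfolding \<delta>_def \<gamma>_def n_def by (simp add: ennreal_leI)
    qed
  qed
qed

theorem corollary3:
  fixes D :: "(real ^ 'n) set" and \<kappa> p s \<beta> :: real
  assumes "0 < \<kappa>" and "\<kappa> < 1"
    and "0 < p" and "0 \<le> real CARD('n) + s * p"
    and "open D" and "D \<noteq> {}" and "D \<noteq> UNIV" and "plump \<kappa> D"
    and "(upper_assouad_dim (frontier D) < ereal (real CARD('n) - s * p + \<beta>) \<and> \<not> bounded D)
       \<or> (lower_assouad_dim (frontier D) > ereal (real CARD('n) - s * p + \<beta>) \<and>
            (bounded D \<or> \<not> bounded (frontier D)))"
  shows "admits_Hardy s p \<beta> D"
proof -
  have dim: "real DIM(real ^ 'n) = real CARD('n)" by simp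
  from assms(9) show ?thesis
  proof (elim disjE)
    assume "upper_assouad_dim (frontier D) < ereal (real CARD('n) - s * p + \<beta>) \<and> \<not> bounded D"
    then show ?thesis
      using assms(1-5,7,8) by (intro Hardy_thin_boundary[of \<kappa>]) (simp_all only: dim simp_thms)
  next
    assume "ereal (real CARD('n) - s * p + \<beta>) < lower_assouad_dim (frontier D) \<and>
      (bounded D \<or> \<not> bounded (frontier D))"
    then show ?thesis
      using assms(1-5,7,8) by (intro Hardy_fat_boundary[of \<kappa>]) (simp_all only: dim simp_thms)
  qed
qed

end
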